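(* Let $G$ be a finite, connected, simple undirected graph with vertices $v_0,\dots,v_n$ and edge set $E$, with sink $v_0$. Let $\mathbb{O}_0$ be the set of $(G,v_0)$-semiorientations, and for $\mathcal{O}\in\mathbb{O}_0$ let $\rho(\mathcal{O})\subseteq\mathbb{R}^{n+1}$ be the set of $x=(x_0,\dots,x_n)$ with $x_j>x_i+1$ for each $(v_i,v_j)\in\mathcal{O}$ and $|x_i-x_j|<1$ for each blank edge $\{v_i,v_j\}$. Let $\pi_0$ send a subset of $\mathbb{R}^{n+1}$ to its image under the projection $(x_0,\dots,x_n)\mapsto(x_1,\dots,x_n)$. Then $\rho_0:=\pi_0\circ\rho$ is a bijection from $\mathbb{O}_0$ onto the set $\mathcal{R}_0$ of regions of the $(G,v_0)$-semiorder arrangement.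
   Context: Partial orientation: $\mathcal{O}\subseteq V\times V$ with $(u,v)\in\mathcal{O}\Rightarrow\{u,v\}\in E$, $(v,u)\notin\mathcal{O}$; non-oriented edges are blank; $\mathrm{outdeg}_{\mathcal{O}}(v)$ is the number of $(v,u)\in\mathcal{O}$. A potential cycle is a cycle of $G$ whose blank edges can be directed to make it directed. A $G$-semiorientation is a partial orientation all of whose potential cycles have strictly more blank edges than oriented edges. A $(G,v_0)$-semiorientation is a $G$-semiorientation $\mathcal{O}$ with $\mathrm{outdeg}_{\mathcal{O}}(v_0)=\deg(v_0)$. The $(G,v_0)$-semiorder arrangement is the set of hyperplanes $x_i-x_j=1$ in $\mathbb{R}^n$ (coordinates $x_1,\dots,x_n$) for all ordered pairs $i\neq j$, both nonzero, with $\{v_i,v_j\}\in E$; its regions are the connected components of the complement of their union. *)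

theory Defs
  imports "HOL-Analysis.Analysis"
begin

definition finite_simple_graph :: "'a set \<Rightarrow> 'a set set \<Rightarrow> bool" where
  "finite_simple_graph V E \<longleftrightarrow> finite V \<and> (\<forall>e\<in>E. e \<subseteq> V \<and> card e = 2)"

definition connected_graph :: "'a set \<Rightarrow> 'a set set \<Rightarrow> bool" where
  "connected_graph V E \<longleftrightarrow> V \<noteq> {} \<and> (\<forall>u\<in>V. \<forall>w\<in>V. (u, w) \<in> {(a, b). {a, b} \<in> E}\<^sup>*)"

definition degree :: "'a set set \<Rightarrow> 'a \<Rightarrow> nat" where
  "degree E u = card {e \<in> E. u \<in> e}"

definition partial_orientation :: "'a set \<Rightarrow> 'a set set \<Rightarrow> ('a \<times> 'a) set \<Rightarrow> bool" where
  "partial_orientation V E \<O> \<longleftrightarrow>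
     \<O> \<subseteq> V \<times> V \<and> (\<forall>(u, w) \<in> \<O>. {u, w} \<in> E \<and> (w, u) \<notin> \<O>)"

definition blank_edge :: "'a set set \<Rightarrow> ('a \<times> 'a) set \<Rightarrow> 'a set \<Rightarrow> bool" where
  "blank_edge E \<O> e \<longleftrightarrow> e \<in> E \<and> \<not> (\<exists>(u, w) \<in> \<O>. e = {u, w})"

definition oriented_edge :: "'a set set \<Rightarrow> ('a \<times> 'a) set \<Rightarrow> 'a set \<Rightarrow> bool" where
  "oriented_edge E \<O> e \<longleftrightarrow> e \<in> E \<and> (\<exists>(u, w) \<in> \<O>. e = {u, w})"

definition outdegree :: "('a \<times> 'a) set \<Rightarrow> 'a \<Rightarrow> nat" where
  "outdegree \<O> u = card {a \<in> \<O>. fst a = u}"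

text \<open>A cycle is given by the cyclic list of its vertices. The same cycle is therefore
  represented by several lists (rotations and reversals), which is harmless below since
  every notion depends only on the underlying edges.\<close>

definition cycle_arcs :: "'a list \<Rightarrow> ('a \<times> 'a) set" where
  "cycle_arcs c = {(c ! i, c ! (Suc i mod length c)) | i. i < length c}"

definition cycle_edges :: "'a list \<Rightarrow> 'a set set" where
  "cycle_edges c = (\<lambda>(u, w). {u, w}) ` cycle_arcs c"

definition cycle_in :: "'a set set \<Rightarrow> 'a list \<Rightarrow> bool" where
  "cycle_in E c \<longleftrightarrow> 3 \<le> length c \<and> distinct c \<and> cycle_edges c \<subseteq> E"

definition directed_cycle :: "('a \<times> 'a) set \<Rightarrow> 'a list \<Rightarrow> bool" where
  "directed_cycle D c \<longleftrightarrow> cycle_arcs c \<subseteq> D \<or> (cycle_arcs c)\<inverse> \<subseteq> D"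

text \<open>Directing blank edges means passing to a larger partial orientation. Whether edges off
  the cycle also get directed is irrelevant.\<close>

definition potential_cycle :: "'a set \<Rightarrow> 'a set set \<Rightarrow> ('a \<times> 'a) set \<Rightarrow> 'a list \<Rightarrow> bool" where
  "potential_cycle V E \<O> c \<longleftrightarrow> cycle_in E c \<and>
     (\<exists>\<O>'. partial_orientation V E \<O>' \<and> \<O> \<subseteq> \<O>' \<and> directed_cycle \<O>' c)"

definition semiorientation :: "'a set \<Rightarrow> 'a set set \<Rightarrow> ('a \<times> 'a) set \<Rightarrow> bool" where
  "semiorientation V E \<O> \<longleftrightarrow> partial_orientation V E \<O> \<and>
     (\<forall>c. potential_cycle V E \<O> c \<longrightarrow>
        card {e \<in> cycle_edges c. oriented_edge E \<O> e} < card {e \<in> cycle_edges c. blank_edge E \<O> e})"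

definition sink_semiorientations :: "'a set \<Rightarrow> 'a set set \<Rightarrow> 'a \<Rightarrow> ('a \<times> 'a) set set" where
  "sink_semiorientations V E s = {\<O>. semiorientation V E \<O> \<and> outdegree \<O> s = degree E s}"

text \<open>The vertices are enumerated as \<open>v 0, \<dots>, v n\<close>. The spaces of points
  \<open>(x\<^sub>0, \<dots>, x\<^sub>n)\<close> and \<open>(x\<^sub>1, \<dots>, x\<^sub>n)\<close> are the topological
  spaces \<^term>\<open>powertop_real {0..n}\<close> and \<^term>\<open>powertop_real {1..n}\<close>. Their points
  are functions that are \<^const>\<open>undefined\<close> outside the index set, so the projection between
  them is \<^const>\<open>restrict\<close>. For \<open>n = 0\<close> the latter space is a single point.\<close>

definition rho :: "nat \<Rightarrow> (nat \<Rightarrow> 'a) \<Rightarrow> 'a set set \<Rightarrow> ('a \<times> 'a) set \<Rightarrow> (nat \<Rightarrow> real) set" where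
  "rho n v E \<O> = {x \<in> topspace (powertop_real {0..n}).
     (\<forall>i\<in>{0..n}. \<forall>j\<in>{0..n}. (v i, v j) \<in> \<O> \<longrightarrow> x j > x i + 1) \<and>
     (\<forall>i\<in>{0..n}. \<forall>j\<in>{0..n}. blank_edge E \<O> {v i, v j} \<longrightarrow> \<bar>x i - x j\<bar> < 1)}"

definition proj0 :: "nat \<Rightarrow> (nat \<Rightarrow> real) set \<Rightarrow> (nat \<Rightarrow> real) set" where
  "proj0 n S = (\<lambda>x. restrict x {1..n}) ` S"

definition semiorder_arrangement :: "nat \<Rightarrow> (nat \<Rightarrow> 'a) \<Rightarrow> 'a set set \<Rightarrow> (nat \<Rightarrow> real) set set" where
  "semiorder_arrangement n v E =
     {{x \<in> topspace (powertop_real {1..n}). x i - x j = 1} | i j.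
        i \<in> {1..n} \<and> j \<in> {1..n} \<and> i \<noteq> j \<and> {v i, v j} \<in> E}"

definition regions :: "nat \<Rightarrow> (nat \<Rightarrow> real) set set \<Rightarrow> (nat \<Rightarrow> real) set set" where
  "regions n \<A> = connected_components_of
     (subtopology (powertop_real {1..n}) (topspace (powertop_real {1..n}) - \<Union>\<A>))"

end

theory Submission
  imports Defs
begin

text \<open>The inequalities defining \<open>\<rho>(\<O>)\<close> form a system of strict difference constraints,
  which is feasible iff every cycle of the constraint digraph has positive weight. The weight of
  a potential cycle is its number of blank edges minus its number of oriented edges, so
  feasibility is exactly the semiorientation condition. Since all edges at the sink are directed
  outwards, \<open>x\<^sub>0\<close> can be chosen very small, and projecting only removes the constraints
  that involve it. A point off the hyperplanes determines its orientation; the set of points with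
  a given orientation is convex, and no difference \<open>x\<^sub>i - x\<^sub>j\<close> along an edge can cross
  \<open>\<plusminus>1\<close> within a connected set, so these sets are the regions.\<close>

section \<open>Cycles\<close>

text \<open>Pairing the list with its rotation reduces sums and counts over arcs to list
  computations.\<close>

lemma cycle_arcs_zip: "cycle_arcs c = set (zip c (rotate1 c))"
  unfolding cycle_arcs_def set_zip by (auto simp: nth_rotate1)

lemma sum_cycle_arcs:
  assumes "distinct c"
  shows "(\<Sum>a\<in>cycle_arcs c. f a) = sum_list (map f (zip c (rotate1 c)))"
  unfolding cycle_arcs_zip
  by (rule sum.distinct_set_conv_list) (simp add: assms distinct_zipI1)

lemma card_cycle_arcs: "distinct c \<Longrightarrow> card (cycle_arcs c) = length c"
  unfolding cycle_arcs_zip by (simp add: distinct_card distinct_zipI1)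

lemma finite_cycle_arcs [simp]: "finite (cycle_arcs c)"
  unfolding cycle_arcs_zip by simp

lemma cycle_arcs_nonempty: "c \<noteq> [] \<Longrightarrow> cycle_arcs c \<noteq> {}"
  unfolding cycle_arcs_def by auto

text \<open>The sources and the targets of the arcs each run once through the vertices of
  \<open>c\<close>, so the two sums cancel.\<close>

lemma sum_cycle_arcs_telescope:
  fixes f :: "'a \<Rightarrow> real"
  assumes "distinct c"
  shows "(\<Sum>(u, w)\<in>cycle_arcs c. f w - f u) = 0"
proof -
  have "(\<Sum>(u, w)\<in>cycle_arcs c. f w - f u)
      = (\<Sum>a\<in>cycle_arcs c. f (snd a)) - (\<Sum>a\<in>cycle_arcs c. f (fst a))"
    by (simp add: case_prod_unfold sum_subtractf)
  also have "(\<Sum>a\<in>cycle_arcs c. f (snd a)) = sum_list (map f (rotate1 c))"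
    by (simp add: sum_cycle_arcs[OF assms] map_zip_map2 flip: map_map[of f snd, unfolded comp_def])
  also have "(\<Sum>a\<in>cycle_arcs c. f (fst a)) = sum_list (map f c)"
    by (simp add: sum_cycle_arcs[OF assms] flip: map_map[of f fst, unfolded comp_def])
  also have "sum_list (map f (rotate1 c)) = sum_list (map f c)"
    by (cases c) simp_all
  finally show ?thesis by simp
qed

text \<open>Two opposite arcs would make some index \<open>i\<close> congruent to
  \<open>i + 2\<close> modulo the length, which a length of at least 3 excludes.\<close>

lemma cycle_arcs_asym:
  assumes "distinct c" "3 \<le> length c" "(u, w) \<in> cycle_arcs c"
  shows "(w, u) \<notin> cycle_arcs c"
proof
  assume "(w, u) \<in> cycle_arcs c"
  let ?l = "length c"
  obtain i where i: "i < ?l" "u = c ! i" "w = c ! (Suc i mod ?l)"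
    using assms(3) unfolding cycle_arcs_def by auto
  obtain j where j: "j < ?l" "w = c ! j" "u = c ! (Suc j mod ?l)"
    using \<open>(w, u) \<in> cycle_arcs c\<close> unfolding cycle_arcs_def by auto
  have "0 < ?l" using i(1) by linarith
  then have "Suc i mod ?l < ?l" "Suc j mod ?l < ?l" by (rule mod_less_divisor)+
  then have "j = Suc i mod ?l" "i = Suc j mod ?l"
    using i j assms(1) by (auto simp: nth_eq_iff_index_eq)
  then show False
    using i(1) j(1) assms(2) by (auto simp: mod_Suc split: if_splits)
qed

text \<open>No edge is traversed in both directions, so the edges of a cycle can be counted through
  its arcs.\<close>

lemma inj_on_cycle_edges:
  assumes "distinct c" "3 \<le> length c"
  shows "inj_on (\<lambda>(u, w). {u, w}) (cycle_arcs c)"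
  using cycle_arcs_asym[OF assms] by (force simp: inj_on_def doubleton_eq_iff)

section \<open>Potentials\<close>

text \<open>The potential of a vertex is the least weight of a path ending there. Appending an arc
  to a path either gives a path or closes a simple cycle, which can be cut off because its
  weight is nonnegative.\<close>

lemma potential_exists:
  fixes wt :: "'a \<times> 'a \<Rightarrow> real"
  assumes "finite V" "A \<subseteq> V \<times> V"
    and cyc: "\<And>c. c \<noteq> [] \<Longrightarrow> distinct c \<Longrightarrow> cycle_arcs c \<subseteq> A \<Longrightarrow> 0 \<le> sum wt (cycle_arcs c)"
  shows "\<exists>p. \<forall>(u, w)\<in>A. p w \<le> p u + wt (u, w)"
proof -
  define W where "W xs = sum_list (map wt (zip xs (tl xs)))" for xs
  define P where "P u = {xs. xs \<noteq> [] \<and> last xs = u \<and> distinct xs \<and> set xs \<subseteq> V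
      \<and> set (zip xs (tl xs)) \<subseteq> A}" for u
  define p where "p u = Min (W ` P u)" for u
  have fin: "finite (P u)" for u
    by (rule finite_subset[OF _ finite_subset_distinct[OF assms(1)]]) (auto simp: P_def)
  \<comment> \<open>The vertex \<open>y\<close> belongs to both pieces, so no arc is lost when a
    path is cut there.\<close>
  have split: "zip (a @ y # b) (tl (a @ y # b)) = zip (a @ [y]) (tl (a @ [y])) @ zip (y # b) b"
    for a b and y :: 'a
  proof (induction a)
    case (Cons x a)
    then show ?case by (cases a) simp_all
  qed simp
  show ?thesis
  proof (intro exI[of _ p] ballI, clarify)
    fix u w assume uw: "(u, w) \<in> A"
    then have V: "u \<in> V" "w \<in> V" using assms(2) by auto
    have "[u] \<in> P u" using V by (simp add: P_def)
    then have "Min (W ` P u) \<in> W ` P u" using fin by (intro Min_in) auto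
    then obtain xs where xs: "xs \<in> P u" "p u = W xs" by (auto simp: p_def)
    have "\<exists>ys\<in>P w. W ys \<le> W xs + wt (u, w)"
    proof (cases "w \<in> set xs")
      case False
      have "xs \<noteq> []" "last xs = u" using xs(1) by (auto simp: P_def)
      then obtain b where b: "xs = b @ [u]" by (metis append_butlast_last_id)
      have "zip (xs @ [w]) (tl (xs @ [w])) = zip xs (tl xs) @ [(u, w)]"
        using split[of b u "[w]"] b by simp
      then show ?thesis
        using False xs(1) uw V by (intro bexI[of _ "xs @ [w]"]) (auto simp: P_def W_def)
    next
      case True
      then obtain a b where ab: "xs = a @ w # b" by (meson split_list)
      have dist: "distinct (w # b)" using xs(1) ab by (auto simp: P_def)
      have last: "last (w # b) = u" using xs(1) ab by (auto simp: P_def)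
      have sp: "zip xs (tl xs) = zip (a @ [w]) (tl (a @ [w])) @ zip (w # b) b"
        using split[of a w b] ab by simp
      \<comment> \<open>Closing the tail adds just the arc \<open>(u, w)\<close>. The result is a
        loop if \<open>b\<close> is empty and a pair of opposite arcs if \<open>b\<close> is a
        single vertex, which is why \<open>cyc\<close> also covers lists of length 1 and 2.\<close>
      have "zip (w # b) (b @ [w]) = zip (w # b) b @ [(u, w)]"
        using last
      proof (induction b arbitrary: w rule: rev_induct)
        case (snoc x b)
        have "zip (w # b @ [x]) ((b @ [x]) @ [z]) = zip (w # b) (b @ [x]) @ zip [x] [z]" for z
          using zip_append[of "w # b" "b @ [x]" "[x]" "[z]"] by simp
        moreover have "zip (w # b @ [x]) (b @ [x]) = zip (w # b) (b @ [x])"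
          using zip_append[of "w # b" "b @ [x]" "[x]" "[]"] by simp
        ultimately show ?case using snoc by simp
      qed simp
      then have z: "zip (w # b) (rotate1 (w # b)) = zip (w # b) b @ [(u, w)]" by simp
      have "cycle_arcs (w # b) \<subseteq> A"
        unfolding cycle_arcs_zip z using xs(1) sp uw by (auto simp: P_def)
      from cyc[OF _ dist this] have "0 \<le> sum_list (map wt (zip (w # b) b)) + wt (u, w)"
        unfolding sum_cycle_arcs[OF dist] z by simp
      moreover have "W xs = W (a @ [w]) + sum_list (map wt (zip (w # b) b))"
        unfolding W_def sp by simp
      moreover have "a @ [w] \<in> P w" using xs(1) sp ab by (auto simp: P_def)
      ultimately show ?thesis by (intro bexI[of _ "a @ [w]"]) auto
    qed
    then obtain ys where "ys \<in> P w" "W ys \<le> W xs + wt (u, w)" by auto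
    moreover have "p w \<le> W ys" unfolding p_def using fin \<open>ys \<in> P w\<close> by auto
    ultimately show "p w \<le> p u + wt (u, w)" using xs by simp
  qed
qed

section \<open>Connected sets of points\<close>

text \<open>A segment is a path because each coordinate is continuous in \<open>t\<close>; the
  restricted lambda keeps it among functions that are \<open>undefined\<close> off
  \<open>I\<close>.\<close>

lemma connectedin_powertop_real_convex:
  assumes "S \<subseteq> topspace (powertop_real I)"
    and conv: "\<And>x y t. x \<in> S \<Longrightarrow> y \<in> S \<Longrightarrow> 0 \<le> t \<Longrightarrow> t \<le> 1 \<Longrightarrow>
      (\<lambda>i\<in>I. (1 - t) * x i + t * y i) \<in> S"
  shows "connectedin (powertop_real I) S"
proof -
  have "path_connectedin (powertop_real I) S"
    unfolding path_connectedin
  proof (intro conjI assms(1) ballI)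
    fix x y assume xy: "x \<in> S" "y \<in> S"
    let ?g = "\<lambda>t. \<lambda>i\<in>I. (1 - t) * x i + t * y i"
    have ext: "x \<in> extensional I" "y \<in> extensional I"
      using xy assms(1) by (auto simp: PiE_def)
    have "pathin (powertop_real I) ?g"
      unfolding pathin_def continuous_map_componentwise
      by (auto intro!: continuous_intros simp: continuous_map_iff_continuous)
    moreover have "?g \<in> {0..1} \<rightarrow> S" using conv[OF xy] by auto
    moreover have "?g 0 = x" "?g 1 = y"
      using ext by (auto simp: extensional_def fun_eq_iff)
    ultimately show "\<exists>g. pathin (powertop_real I) g \<and> g \<in> {0..1} \<rightarrow> S \<and> g 0 = x \<and> g 1 = y"
      by blast
  qed
  then show ?thesis by (rule path_connectedin_imp_connectedin)
qed

text \<open>Intermediate value theorem: the image of \<open>C\<close> under the coordinate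
  difference is an interval that misses \<open>a\<close>.\<close>

lemma connectedin_powertop_real_diff_less:
  assumes C: "connectedin (powertop_real I) C" and ij: "i \<in> I" "j \<in> I"
    and ne: "\<And>x. x \<in> C \<Longrightarrow> x i - x j \<noteq> a"
    and yz: "y \<in> C" "z \<in> C" and "y i - y j < a"
  shows "z i - z j < a"
proof (rule ccontr)
  assume "\<not> z i - z j < a"
  then have z: "a \<le> z i - z j" by simp
  have "continuous_map (powertop_real I) euclideanreal (\<lambda>x. x i - x j)"
    using ij by (intro continuous_intros continuous_map_product_projection)
  from connectedin_continuous_map_image[OF this C]
  have "connected ((\<lambda>x. x i - x j) ` C)" by simp
  then have "a \<in> (\<lambda>x. x i - x j) ` C"
    by (rule connectedD_interval[OF _ imageI[OF yz(1)] imageI[OF yz(2)] less_imp_le[OF assms(7)] z])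
  then show False using ne by auto
qed

section \<open>Semiorientations and points\<close>

lemma oriented_edge_iff:
  assumes "partial_orientation V E X"
  shows "oriented_edge E X {u, w} \<longleftrightarrow> (u, w) \<in> X \<or> (w, u) \<in> X"
proof -
  have "{u, w} \<in> E" if "(u, w) \<in> X \<or> (w, u) \<in> X"
    using assms that unfolding partial_orientation_def by (auto simp: doubleton_eq_iff insert_commute[of u w])
  then show ?thesis unfolding oriented_edge_def by (auto simp: doubleton_eq_iff)
qed

lemma blank_edge_iff:
  "blank_edge E X {u, w} \<longleftrightarrow> {u, w} \<in> E \<and> (u, w) \<notin> X \<and> (w, u) \<notin> X"
  unfolding blank_edge_def by (auto simp: doubleton_eq_iff)

section \<open>Finite simple graphs with enumerated vertices\<close>

locale enumerated_graph =
  fixes V :: "'a set" and E :: "'a set set" and v :: "nat \<Rightarrow> 'a" and n :: nat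
  assumes graph: "finite_simple_graph V E"
    and enum: "bij_betw v {0..n} V"
begin

lemma finite_V: "finite V"
  using graph by (simp add: finite_simple_graph_def)

lemma edge_vertices: "{u, w} \<in> E \<Longrightarrow> u \<in> V \<and> w \<in> V \<and> u \<noteq> w"
  using graph unfolding finite_simple_graph_def by fastforce

lemma finite_E: "finite E"
  using graph by (auto simp: finite_simple_graph_def intro!: finite_subset[of E "Pow V"])

lemma v_in: "i \<le> n \<Longrightarrow> v i \<in> V"
  using enum by (auto simp: bij_betw_def)

lemma v_eq_iff: "i \<le> n \<Longrightarrow> j \<le> n \<Longrightarrow> v i = v j \<longleftrightarrow> i = j"
  using enum by (auto simp: bij_betw_def inj_on_def)

lemma v_cases:
  assumes "u \<in> V" obtains i where "i \<le> n" "u = v i"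
  using assms enum by (auto simp: bij_betw_def)

definition vertex_index :: "'a \<Rightarrow> nat" where
  "vertex_index = inv_into {0..n} v"

lemma vertex_index_v [simp]: "i \<le> n \<Longrightarrow> vertex_index (v i) = i"
  using enum by (simp add: vertex_index_def bij_betw_def)

text \<open>A potential satisfies only weak inequalities, so the strict ones are tightened by a
  slack \<open>e\<close>: arcs of \<open>X\<close> get weight \<open>-1 - e\<close>, and both
  directions of a blank edge get \<open>1 - e\<close>.\<close>

lemma semiorientation_imp_rho_nonempty:
  assumes semi: "semiorientation V E X"
  shows "rho n v E X \<noteq> {}"
proof -
  have po: "partial_orientation V E X" using semi by (simp add: semiorientation_def)
  define B where "B = {(u, w). blank_edge E X {u, w}}"
  \<comment> \<open>A simple cycle has at most \<open>card V\<close> arcs, so its total slack is at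
    most 1.\<close>
  define e :: real where "e = 1 / (card V + 1)"
  have e: "0 < e" "e \<le> 1" "e * card V \<le> 1" by (auto simp: e_def field_simps)
  define wt :: "'a \<times> 'a \<Rightarrow> real" where "wt a = (if a \<in> X then - 1 else 1) - e" for a
  have XE: "{u, w} \<in> E" "(w, u) \<notin> X" if "(u, w) \<in> X" for u w
    using po that by (auto simp: partial_orientation_def)
  have AE: "{u, w} \<in> E" "(w, u) \<notin> X" if "(u, w) \<in> X \<union> B" for u w
    using that XE by (auto simp: B_def blank_edge_iff)
  have cyc: "0 \<le> sum wt (cycle_arcs c)"
    if c: "c \<noteq> []" "distinct c" "cycle_arcs c \<subseteq> X \<union> B" for c
  proof (cases "3 \<le> length c")
    case False
    \<comment> \<open>A list of one or two vertices is no cycle of the graph. It contains the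
      reverse of each of its arcs, so none of them lies in \<open>X\<close> and every weight is
      \<open>1 - e\<close>.\<close>
    have "wt a \<ge> 0" if a: "a \<in> cycle_arcs c" for a
    proof -
      obtain u w where uw: "a = (u, w)" by force
      have "length c \<noteq> 0" using c(1) by simp
      then have "length c = 1 \<or> length c = 2" using False by linarith
      then have "(w, u) \<in> cycle_arcs c"
        using a uw by (auto simp: cycle_arcs_zip length_Suc_conv eval_nat_numeral)
      then have "(u, w) \<notin> X" using AE(2) c(3) by blast
      then show ?thesis using e uw by (simp add: wt_def)
    qed
    then show ?thesis by (rule sum_nonneg)
  next
    case True
    note inj = inj_on_cycle_edges[OF c(2) True]
    \<comment> \<open>\<open>Y\<close> is the larger orientation that witnesses \<open>c\<close> as
      a potential cycle.\<close>
    define Y where "Y = X \<union> cycle_arcs c"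
    have YA: "Y \<subseteq> X \<union> B" using c(3) by (auto simp: Y_def)
    have "(w, u) \<notin> Y" if "(u, w) \<in> Y" for u w
    proof -
      have "(w, u) \<notin> X" using that YA AE(2) by blast
      moreover have "(w, u) \<notin> cycle_arcs c"
        using that cycle_arcs_asym[OF c(2) True] AE(2) c(3) by (auto simp: Y_def)
      ultimately show ?thesis by (simp add: Y_def)
    qed
    then have "partial_orientation V E Y"
      using YA AE(1) edge_vertices[OF AE(1)] unfolding partial_orientation_def by fast
    moreover have "cycle_in E c"
      using True c AE by (auto simp: cycle_in_def cycle_edges_def)
    ultimately have "potential_cycle V E X c"
      unfolding potential_cycle_def directed_cycle_def by (auto simp: Y_def)
    then have less: "card {e \<in> cycle_edges c. oriented_edge E X e} < card {e \<in> cycle_edges c. blank_edge E X e}"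
      using semi by (auto simp: semiorientation_def)
    have or: "{e \<in> cycle_edges c. oriented_edge E X e} = (\<lambda>(u, w). {u, w}) ` (cycle_arcs c \<inter> X)"
      using c(3) AE(2) po by (fastforce simp: cycle_edges_def oriented_edge_iff)
    have bl: "{e \<in> cycle_edges c. blank_edge E X e} = (\<lambda>(u, w). {u, w}) ` (cycle_arcs c - X)"
      using c(3) AE by (fastforce simp: cycle_edges_def blank_edge_iff)
    have "card (cycle_arcs c \<inter> X) < card (cycle_arcs c - X)"
      using less unfolding or bl
      by (simp add: card_image inj_on_subset[OF inj])
    \<comment> \<open>The counts are integers, so the strict inequality has a margin of 1, which
      pays for the slack.\<close>
    then have "1 \<le> real (card (cycle_arcs c - X)) - real (card (cycle_arcs c \<inter> X))" by linarith
    moreover have "sum wt (cycle_arcs c) =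
        real (card (cycle_arcs c - X)) - real (card (cycle_arcs c \<inter> X)) - e * length c"
      by (simp add: wt_def sum_subtractf sum.If_cases card_cycle_arcs c(2) Diff_eq mult.commute)
    moreover have "length c \<le> card V"
    proof -
      have "set c \<subseteq> V"
      proof
        fix u assume "u \<in> set c"
        then obtain i where "i < length c" "u = c ! i" by (auto simp: in_set_conv_nth)
        then have "(u, c ! (Suc i mod length c)) \<in> cycle_arcs c" by (auto simp: cycle_arcs_def)
        then show "u \<in> V" using c(3) AE(1) edge_vertices by blast
      qed
      then show ?thesis using card_mono[OF finite_V] distinct_card[OF c(2)] by metis
    qed
    then have "e * length c \<le> e * card V" using e by simp
    ultimately show ?thesis using e by linarith
  qed
  have "X \<union> B \<subseteq> V \<times> V" using edge_vertices[OF AE(1)] by fast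
  from potential_exists[OF finite_V this cyc]
  obtain p where p: "\<And>u w. (u, w) \<in> X \<union> B \<Longrightarrow> p w \<le> p u + wt (u, w)" by blast
  \<comment> \<open>A potential bounds the target of an arc from above, whereas an oriented edge
    bounds it from below; hence the sign.\<close>
  have "(\<lambda>i\<in>{0..n}. - p (v i)) \<in> rho n v E X"
  proof -
    have "- p w > - p u + 1" if "(u, w) \<in> X" for u w
      using p[of u w] that e by (simp add: wt_def)
    moreover have "\<bar>- p u - - p w\<bar> < 1" if "blank_edge E X {u, w}" for u w
    proof -
      have "(u, w) \<in> B" "(w, u) \<in> B" "(u, w) \<notin> X" "(w, u) \<notin> X"
        using that by (auto simp: B_def insert_commute blank_edge_iff)
      then show ?thesis using p[of u w] p[of w u] e by (simp add: wt_def)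
    qed
    ultimately show ?thesis unfolding rho_def by auto
  qed
  then show ?thesis by blast
qed

text \<open>Along a directed potential cycle the increments of \<open>x\<close> sum to zero, exceed \<open>1\<close>
  on oriented edges, and exceed \<open>-1\<close> on blank ones.\<close>

lemma rho_nonempty_imp_semiorientation:
  assumes po: "partial_orientation V E X" and x: "x \<in> rho n v E X"
  shows "semiorientation V E X"
  unfolding semiorientation_def
proof (intro conjI po allI impI)
  fix c assume pc: "potential_cycle V E X c"
  then have c: "distinct c" "3 \<le> length c" "cycle_edges c \<subseteq> E"
    by (auto simp: potential_cycle_def cycle_in_def)
  obtain Y where Y: "partial_orientation V E Y" "X \<subseteq> Y" "directed_cycle Y c"
    using pc by (auto simp: potential_cycle_def)
  \<comment> \<open>\<open>Y\<close> may direct the cycle against the order of the list;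
    \<open>D\<close> takes the arcs in the sense that \<open>Y\<close> contains.\<close>
  define D where "D = (if cycle_arcs c \<subseteq> Y then cycle_arcs c else (cycle_arcs c)\<inverse>)"
  have DY: "D \<subseteq> Y" using Y(3) by (auto simp: D_def directed_cycle_def)
  have fin: "finite D" by (simp add: D_def)
  have edges: "cycle_edges c = (\<lambda>(u, w). {u, w}) ` D"
    by (force simp: D_def cycle_edges_def insert_commute image_iff)
  have Yasym: "(w, u) \<notin> Y" if "(u, w) \<in> Y" for u w
    using Y(1) that by (auto simp: partial_orientation_def)
  have inj: "inj_on (\<lambda>(u, w). {u, w}) D"
  proof (rule inj_onI, clarify)
    fix u w u' w' assume D: "(u, w) \<in> D" "(u', w') \<in> D" and "{u, w} = {u', w'}"
    moreover have "(w, u) \<notin> D" using D(1) DY Yasym by blast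
    ultimately show "u = u' \<and> w = w'" by (auto simp: doubleton_eq_iff)
  qed
  define f where "f u = x (vertex_index u)" for u
  have "(\<Sum>(u, w)\<in>(cycle_arcs c)\<inverse>. f w - f u) = (\<Sum>(u, w)\<in>cycle_arcs c. f u - f w)"
    by (rule sum.reindex_bij_witness[of _ prod.swap prod.swap]) auto
  also have "\<dots> = - (\<Sum>(u, w)\<in>cycle_arcs c. f w - f u)"
    by (simp add: case_prod_unfold flip: sum_negf)
  finally have tele: "(\<Sum>(u, w)\<in>D. f w - f u) = 0"
    using sum_cycle_arcs_telescope[OF c(1), of f] by (simp add: D_def)
  have "c \<noteq> []" using c(2) by auto
  then have "D \<noteq> {}" using cycle_arcs_nonempty by (auto simp: D_def)
  have strict: "(if (u, w) \<in> X then 1 else - 1) < f w - f u" if uw: "(u, w) \<in> D" for u w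
  proof -
    have E: "{u, w} \<in> E" using uw edges c(3) by auto
    then obtain i j where ij: "i \<le> n" "u = v i" "j \<le> n" "w = v j"
      using edge_vertices by (meson v_cases)
    have "(w, u) \<notin> X" using Yasym uw DY Y(2) by blast
    have gt: "x j > x i + 1" if "(v i, v j) \<in> X"
      using x ij that by (simp add: rho_def)
    have "blank_edge E X {v i, v j} \<Longrightarrow> \<bar>x i - x j\<bar> < 1"
      using x ij by (simp add: rho_def)
    then have "\<bar>x i - x j\<bar> < 1" if "(v i, v j) \<notin> X"
      using that E ij \<open>(w, u) \<notin> X\<close> by (simp add: blank_edge_iff)
    then show ?thesis using gt ij by (auto simp: f_def abs_less_iff)
  qed
  \<comment> \<open>The right side telescopes to 0, and the left side is the number of oriented arcs
    minus the number of blank ones.\<close>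
  have "(\<Sum>a\<in>D. if a \<in> X then 1 else - 1 :: real) < (\<Sum>(u, w)\<in>D. f w - f u)"
  proof (intro sum_strict_mono fin \<open>D \<noteq> {}\<close>)
    show "(if a \<in> X then 1 else - 1) < (case a of (u, w) \<Rightarrow> f w - f u)" if "a \<in> D" for a
      using strict[of "fst a" "snd a"] that by (simp add: case_prod_unfold)
  qed
  then have "real (card (D \<inter> X)) < card (D - X)"
    unfolding tele by (simp add: sum.If_cases fin Diff_eq)
  moreover have "{e \<in> cycle_edges c. oriented_edge E X e} = (\<lambda>(u, w). {u, w}) ` (D \<inter> X)"
    using DY Yasym Y(2) po unfolding edges by (fastforce simp: oriented_edge_iff)
  moreover have "{e \<in> cycle_edges c. blank_edge E X e} = (\<lambda>(u, w). {u, w}) ` (D - X)"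
    using DY Yasym Y(2) c(3) unfolding edges by (fastforce simp: blank_edge_iff)
  ultimately show "card {e \<in> cycle_edges c. oriented_edge E X e} < card {e \<in> cycle_edges c. blank_edge E X e}"
    by (simp add: card_image inj_on_subset[OF inj])
qed

text \<open>Forgetting direction injects the arcs leaving \<open>s\<close> into the finite set of
  edges at \<open>s\<close>; equal cardinality means that every edge is hit.\<close>

lemma outdegree_eq_degree_iff:
  assumes po: "partial_orientation V E X"
  shows "outdegree X s = degree E s \<longleftrightarrow> (\<forall>w. {s, w} \<in> E \<longrightarrow> (s, w) \<in> X)"
proof -
  let ?D = "{e \<in> E. s \<in> e}"
  let ?f = "\<lambda>a::'a \<times> 'a. {fst a, snd a}"
  let ?O = "{a \<in> X. fst a = s}"
  have inj: "inj_on ?f ?O" by (auto simp: inj_on_def doubleton_eq_iff)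
  have sub: "?f ` ?O \<subseteq> ?D" using po by (auto simp: partial_orientation_def)
  have fin: "finite ?D" using finite_E by simp
  have "outdegree X s = card (?f ` ?O)" by (simp only: outdegree_def card_image[OF inj])
  then have "outdegree X s = degree E s \<longleftrightarrow> ?f ` ?O = ?D"
    using card_subset_eq[OF fin sub] by (auto simp: degree_def)
  also have "\<dots> \<longleftrightarrow> ?D \<subseteq> ?f ` ?O" using sub by blast
  also have "\<dots> \<longleftrightarrow> (\<forall>w. {s, w} \<in> E \<longrightarrow> (s, w) \<in> X)"
  proof
    assume D: "?D \<subseteq> ?f ` ?O"
    show "\<forall>w. {s, w} \<in> E \<longrightarrow> (s, w) \<in> X"
    proof (intro allI impI)
      fix w assume "{s, w} \<in> E"
      then have "{s, w} \<in> ?f ` ?O" using D by blast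
      then show "(s, w) \<in> X" by (auto simp: doubleton_eq_iff)
    qed
  next
    assume all: "\<forall>w. {s, w} \<in> E \<longrightarrow> (s, w) \<in> X"
    show "?D \<subseteq> ?f ` ?O"
    proof
      fix e assume e: "e \<in> ?D"
      then have "card e = 2" using graph by (auto simp: finite_simple_graph_def)
      then obtain w where "e = {s, w}" using e by (auto simp: card_2_iff)
      then show "e \<in> ?f ` ?O" using all e by (intro image_eqI[of _ _ "(s, w)"]) auto
    qed
  qed
  finally show ?thesis .
qed

lemma sink_semiorientations_iff:
  "X \<in> sink_semiorientations V E (v 0) \<longleftrightarrow>
     semiorientation V E X \<and> (\<forall>w. {v 0, w} \<in> E \<longrightarrow> (v 0, w) \<in> X)"
  unfolding sink_semiorientations_def
  using outdegree_eq_degree_iff by (auto simp: semiorientation_def)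

text \<open>The orientation read off from a point. An edge with difference exactly 1 stays blank, so
  \<open>x\<close> lies in \<open>rho\<close> of it only off such differences.\<close>

definition orient :: "(nat \<Rightarrow> real) \<Rightarrow> ('a \<times> 'a) set" where
  "orient x = {(v i, v j) | i j. i \<le> n \<and> j \<le> n \<and> {v i, v j} \<in> E \<and> x j > x i + 1}"

lemma orient_iff:
  "i \<le> n \<Longrightarrow> j \<le> n \<Longrightarrow> (v i, v j) \<in> orient x \<longleftrightarrow> {v i, v j} \<in> E \<and> x j > x i + 1"
  unfolding orient_def using v_eq_iff by auto

lemma partial_orientation_orient: "partial_orientation V E (orient x)"
  unfolding partial_orientation_def
proof (intro conjI)
  show "orient x \<subseteq> V \<times> V" using v_in by (auto simp: orient_def)
  show "\<forall>(u, w)\<in>orient x. {u, w} \<in> E \<and> (w, u) \<notin> orient x"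
  proof clarify
    fix u w assume "(u, w) \<in> orient x"
    then obtain i j where "i \<le> n" "j \<le> n" "u = v i" "w = v j" "{v i, v j} \<in> E" "x j > x i + 1"
      unfolding orient_def by blast
    then show "{u, w} \<in> E \<and> (w, u) \<notin> orient x" by (auto simp: orient_iff)
  qed
qed

text \<open>A difference above 1 rules out a blank edge and the opposite arc, so the point
  determines the status of every edge. Injectivity rests on this.\<close>

lemma orient_eq:
  assumes po: "partial_orientation V E X" and x: "x \<in> rho n v E X"
  shows "orient x = X"
proof (intro equalityI subrelI)
  fix u w assume "(u, w) \<in> orient x"
  then obtain i j where ij: "i \<le> n" "j \<le> n" "u = v i" "w = v j" "{v i, v j} \<in> E" "x j > x i + 1"
    unfolding orient_def by blast
  then have "\<not> blank_edge E X {v i, v j}" "(v j, v i) \<notin> X"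
    using x by (force simp: rho_def)+
  then show "(u, w) \<in> X" using ij by (auto simp: blank_edge_iff)
next
  fix u w assume uw: "(u, w) \<in> X"
  then have "{u, w} \<in> E" "u \<in> V" "w \<in> V" using po by (auto simp: partial_orientation_def)
  then show "(u, w) \<in> orient x"
    using uw x by (auto simp: rho_def orient_iff elim!: v_cases)
qed

section \<open>Regions\<close>

lemma exists_sink_coordinate: "\<exists>m::real. \<forall>j\<in>{1..n}. m + 1 < y j"
proof -
  have "Min (insert 0 (y ` {1..n})) \<le> y j" if "j \<in> {1..n}" for j
    using that by (intro Min_le) auto
  \<comment> \<open>The inserted 0 keeps the set nonempty when \<open>n = 0\<close>; subtracting 2
    makes the inequality strict.\<close>
  then show ?thesis by (intro exI[of _ "Min (insert 0 (y ` {1..n})) - 2"]) force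
qed

text \<open>Constraints at the sink all read \<open>x j > x 0 + 1\<close>, so a low
  \<open>x 0\<close> meets them without affecting the other coordinates.\<close>

lemma proj0_rho:
  assumes X: "X \<in> sink_semiorientations V E (v 0)"
  shows "proj0 n (rho n v E X) = {y \<in> topspace (powertop_real {1..n}).
     (\<forall>i\<in>{1..n}. \<forall>j\<in>{1..n}. (v i, v j) \<in> X \<longrightarrow> y j > y i + 1) \<and>
     (\<forall>i\<in>{1..n}. \<forall>j\<in>{1..n}. blank_edge E X {v i, v j} \<longrightarrow> \<bar>y i - y j\<bar> < 1)}" (is "_ = ?R")
proof (intro equalityI subsetI)
  fix y assume "y \<in> proj0 n (rho n v E X)"
  then show "y \<in> ?R" by (auto simp: proj0_def rho_def)
next
  fix y assume y: "y \<in> ?R"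
  obtain m where m: "\<forall>j\<in>{1..n}. m + 1 < y j" using exists_sink_coordinate by blast
  define x where "x = y(0 := m)"
  have po: "partial_orientation V E X" and out: "\<And>w. {v 0, w} \<in> E \<Longrightarrow> (v 0, w) \<in> X"
    using X by (auto simp: sink_semiorientations_iff semiorientation_def)
  have XE: "{u, w} \<in> E" "(w, u) \<notin> X" if "(u, w) \<in> X" for u w
    using po that by (auto simp: partial_orientation_def)
  \<comment> \<open>The sink occurs only as the source of arcs, so \<open>m\<close> is never bounded
    from below.\<close>
  have in0: "(u, v 0) \<notin> X" for u
    using XE out by (metis insert_commute)
  have bl0: "\<not> blank_edge E X {v 0, w}" "\<not> blank_edge E X {w, v 0}" for w
    using out by (auto simp: blank_edge_iff insert_commute)
  have pos: "i \<in> {1..n} \<longleftrightarrow> i \<noteq> 0" if "i \<in> {0..n}" for i using that by auto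
  have "x \<in> rho n v E X"
    unfolding rho_def
  proof (intro CollectI conjI ballI impI)
    show "x \<in> topspace (powertop_real {0..n})"
      using y by (auto simp: x_def PiE_def extensional_def)
  next
    fix i j assume ij: "i \<in> {0..n}" "j \<in> {0..n}" "(v i, v j) \<in> X"
    then have "j \<noteq> 0" using in0 by metis
    then show "x j > x i + 1" using ij y m pos by (cases "i = 0") (auto simp: x_def)
  next
    fix i j assume ij: "i \<in> {0..n}" "j \<in> {0..n}" "blank_edge E X {v i, v j}"
    then have "i \<noteq> 0" "j \<noteq> 0" using bl0 by metis+
    then show "\<bar>x i - x j\<bar> < 1" using ij y pos by (auto simp: x_def)
  qed
  \<comment> \<open>\<open>y\<close> is \<open>undefined\<close> at 0, so restricting undoes the
    update.\<close>
  moreover have "restrict x {1..n} = y"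
    using y by (auto simp: x_def fun_eq_iff PiE_def extensional_def restrict_def)
  ultimately show "y \<in> proj0 n (rho n v E X)" by (auto simp: proj0_def)
qed

lemma connectedin_proj0_rho:
  assumes X: "X \<in> sink_semiorientations V E (v 0)"
  shows "connectedin (powertop_real {1..n}) (proj0 n (rho n v E X))"
proof (rule connectedin_powertop_real_convex)
  show "proj0 n (rho n v E X) \<subseteq> topspace (powertop_real {1..n})"
    unfolding proj0_rho[OF X] by blast
next
  fix x y and t :: real
  assume x: "x \<in> proj0 n (rho n v E X)" and y: "y \<in> proj0 n (rho n v E X)" and t: "0 \<le> t" "t \<le> 1"
  \<comment> \<open>For \<open>t = 0\<close> the \<open>b\<close> terms vanish and strictness must
    come from \<open>a < a'\<close>; otherwise it comes from \<open>b < b'\<close>.\<close>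
  have less: "(1 - t) * a + t * b < (1 - t) * a' + t * b'" if "a < a'" "b < b'" for a b a' b' :: real
  proof (cases "t = 0")
    case False
    then have "t * b < t * b'" using t that by simp
    moreover have "(1 - t) * a \<le> (1 - t) * a'" using t that by (intro mult_left_mono) auto
    ultimately show ?thesis by linarith
  qed (use that in simp)
  show "(\<lambda>i\<in>{1..n}. (1 - t) * x i + t * y i) \<in> proj0 n (rho n v E X)"
    unfolding proj0_rho[OF X]
  proof (intro CollectI conjI ballI impI)
    fix i j assume ij: "i \<in> {1..n}" "j \<in> {1..n}" "(v i, v j) \<in> X"
    then have "x i + 1 < x j" "y i + 1 < y j" using x y unfolding proj0_rho[OF X] by auto
    from less[OF this] show "(\<lambda>i\<in>{1..n}. (1 - t) * x i + t * y i) i + 1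
        < (\<lambda>i\<in>{1..n}. (1 - t) * x i + t * y i) j"
      using ij by (simp add: algebra_simps)
  next
    fix i j assume ij: "i \<in> {1..n}" "j \<in> {1..n}" "blank_edge E X {v i, v j}"
    then have "\<bar>x i - x j\<bar> < 1" "\<bar>y i - y j\<bar> < 1" using x y unfolding proj0_rho[OF X] by auto
    then have "x i < x j + 1" "y i < y j + 1" "x j < x i + 1" "y j < y i + 1" by auto
    from less[OF this(1,2)] less[OF this(3,4)]
    show "\<bar>(\<lambda>i\<in>{1..n}. (1 - t) * x i + t * y i) i - (\<lambda>i\<in>{1..n}. (1 - t) * x i + t * y i) j\<bar> < 1"
      using ij by (simp add: algebra_simps abs_less_iff)
  qed simp
qed

section \<open>The complement of the arrangement and its components\<close>

abbreviation arrangement_complement :: "(nat \<Rightarrow> real) set" where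
  "arrangement_complement \<equiv>
     topspace (powertop_real {1..n}) - \<Union>(semiorder_arrangement n v E)"

lemma arrangement_complement_iff:
  "y \<in> arrangement_complement \<longleftrightarrow> y \<in> topspace (powertop_real {1..n}) \<and>
     (\<forall>i\<in>{1..n}. \<forall>j\<in>{1..n}. {v i, v j} \<in> E \<longrightarrow> y i - y j \<noteq> 1)"
  unfolding semiorder_arrangement_def using edge_vertices by blast

lemma proj0_rho_subset:
  assumes X: "X \<in> sink_semiorientations V E (v 0)"
  shows "proj0 n (rho n v E X) \<subseteq> arrangement_complement"
proof
  fix y assume y: "y \<in> proj0 n (rho n v E X)"
  have "y i - y j \<noteq> 1" if "i \<in> {1..n}" "j \<in> {1..n}" "{v i, v j} \<in> E" for i j
  proof -
    have "(v i, v j) \<in> X \<or> (v j, v i) \<in> X \<or> blank_edge E X {v i, v j}"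
      using that unfolding blank_edge_iff by argo
    moreover have "(v i, v j) \<in> X \<Longrightarrow> y j > y i + 1" "(v j, v i) \<in> X \<Longrightarrow> y i > y j + 1"
      "blank_edge E X {v i, v j} \<Longrightarrow> \<bar>y i - y j\<bar> < 1"
      using y that(1,2) unfolding proj0_rho[OF X] by simp_all
    ultimately show ?thesis by linarith
  qed
  then show "y \<in> arrangement_complement"
    using y unfolding arrangement_complement_iff proj0_rho[OF X] by blast
qed

text \<open>Lift \<open>y\<close> by a sink coordinate more than 1 below all others and read off the
  orientation: every edge at the sink then points outwards, and no edge has difference 1 in either
  order.\<close>

lemma sink_semiorientation_of_point:
  assumes y: "y \<in> arrangement_complement"
  shows "\<exists>X\<in>sink_semiorientations V E (v 0). y \<in> proj0 n (rho n v E X)"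
proof -
  obtain m where m: "\<forall>j\<in>{1..n}. m + 1 < y j" using exists_sink_coordinate by blast
  define x where "x = y(0 := m)"
  have y': "y \<in> topspace (powertop_real {1..n})"
    and ne: "\<And>i j. i \<in> {1..n} \<Longrightarrow> j \<in> {1..n} \<Longrightarrow> {v i, v j} \<in> E \<Longrightarrow> y i - y j \<noteq> 1"
    using y unfolding arrangement_complement_iff by blast+
  have ne1: "x i - x j \<noteq> 1" if ij: "i \<in> {0..n}" "j \<in> {0..n}" "{v i, v j} \<in> E" for i j
  proof -
    have "i \<noteq> j" using edge_vertices that by blast
    then consider "i = 0" "j \<in> {1..n}" | "j = 0" "i \<in> {1..n}" | "i \<in> {1..n}" "j \<in> {1..n}"
      using ij(1,2) by force
    then show ?thesis
    proof cases
      case 1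
      then have "m + 1 < y j" using m by blast
      then show ?thesis using 1 by (simp add: x_def)
    next
      case 2
      then have "m + 1 < y i" using m by blast
      then show ?thesis using 2 by (simp add: x_def)
    next
      case 3
      then show ?thesis using ne[OF 3 ij(3)] by (simp add: x_def)
    qed
  qed
  have rho: "x \<in> rho n v E (orient x)"
    unfolding rho_def
  proof (intro CollectI conjI ballI impI)
    show "x \<in> topspace (powertop_real {0..n})"
      using y' by (auto simp: x_def PiE_def extensional_def)
  next
    fix i j assume "i \<in> {0..n}" "j \<in> {0..n}" "(v i, v j) \<in> orient x"
    then show "x j > x i + 1" by (simp add: orient_iff)
  next
    fix i j assume ij: "i \<in> {0..n}" "j \<in> {0..n}" "blank_edge E (orient x) {v i, v j}"
    then have E: "{v i, v j} \<in> E" "{v j, v i} \<in> E" by (auto simp: blank_edge_iff insert_commute)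
    \<comment> \<open>Blankness gives only \<open>\<bar>x i - x j\<bar> \<le> 1\<close>;
      \<open>ne1\<close>, used in both orders, excludes equality.\<close>
    then show "\<bar>x i - x j\<bar> < 1"
      using ij ne1[of i j] ne1[of j i] by (force simp: blank_edge_iff orient_iff)
  qed
  have "orient x \<in> sink_semiorientations V E (v 0)"
    unfolding sink_semiorientations_iff
  proof (intro conjI allI impI)
    show "semiorientation V E (orient x)"
      using rho_nonempty_imp_semiorientation[OF partial_orientation_orient rho] .
    fix w assume w: "{v 0, w} \<in> E"
    then obtain j where j: "j \<le> n" "w = v j" using edge_vertices by (meson v_cases)
    then have "j \<noteq> 0" using edge_vertices[OF w] by metis
    then show "(v 0, w) \<in> orient x" using w j m by (simp add: orient_iff x_def)
  qed
  moreover have "restrict x {1..n} = y"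
    using y' by (auto simp: x_def fun_eq_iff PiE_def extensional_def restrict_def)
  ultimately show ?thesis using rho unfolding proj0_def by blast
qed

lemma connected_component_eq_proj0_rho:
  assumes X: "X \<in> sink_semiorientations V E (v 0)" and y: "y \<in> proj0 n (rho n v E X)"
  shows "connected_component_of_set (subtopology (powertop_real {1..n}) arrangement_complement) y
    = proj0 n (rho n v E X)" (is "connected_component_of_set ?T y = _")
proof
  let ?C = "connected_component_of_set ?T y"
  have "connectedin ?T (proj0 n (rho n v E X))"
    unfolding connectedin_subtopology using connectedin_proj0_rho[OF X] proj0_rho_subset[OF X] by blast
  then show sub: "proj0 n (rho n v E X) \<subseteq> ?C"
    using connected_component_of_maximal y by metis
  have "connectedin ?T ?C" by (rule connectedin_connected_component_of)
  then have C: "connectedin (powertop_real {1..n}) ?C" and CA: "?C \<subseteq> arrangement_complement"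
    by (simp_all add: connectedin_subtopology)
  have yC: "y \<in> ?C" using sub y by blast
  have E: "{u, w} \<in> E" if "(u, w) \<in> X" for u w
    using X that by (auto simp: sink_semiorientations_iff semiorientation_def partial_orientation_def)
  \<comment> \<open>The intermediate value argument runs from \<open>y\<close> to \<open>z\<close>
    and back. Applied to both orders of an edge, it fixes the side of 1 and of -1.\<close>
  have iff: "z i - z j < 1 \<longleftrightarrow> y i - y j < 1"
    if "z \<in> ?C" "i \<in> {1..n}" "j \<in> {1..n}" "{v i, v j} \<in> E" for z i j
  proof -
    have "x i - x j \<noteq> 1" if "x \<in> ?C" for x
      using CA that \<open>i \<in> {1..n}\<close> \<open>j \<in> {1..n}\<close> \<open>{v i, v j} \<in> E\<close> arrangement_complement_iff by blast
    then show ?thesis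
      using connectedin_powertop_real_diff_less[OF C that(2,3)] yC that(1) by blast
  qed
  show "?C \<subseteq> proj0 n (rho n v E X)"
  proof
    fix z assume z: "z \<in> ?C"
    then have zA: "z \<in> arrangement_complement" using CA by blast
    show "z \<in> proj0 n (rho n v E X)"
      unfolding proj0_rho[OF X]
    proof (intro CollectI conjI ballI impI)
      show "z \<in> topspace (powertop_real {1..n})" using zA by blast
    next
      fix i j assume ij: "i \<in> {1..n}" "j \<in> {1..n}" "(v i, v j) \<in> X"
      then have e: "{v j, v i} \<in> E" using E by (simp add: insert_commute)
      have "y j > y i + 1" using y ij unfolding proj0_rho[OF X] by auto
      then have "\<not> z j - z i < 1" using iff[OF z ij(2,1) e] by auto
      moreover have "z j - z i \<noteq> 1" using zA ij e arrangement_complement_iff by blast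
      ultimately show "z j > z i + 1" by auto
    next
      fix i j assume ij: "i \<in> {1..n}" "j \<in> {1..n}" "blank_edge E X {v i, v j}"
      then have e: "{v j, v i} \<in> E" "{v i, v j} \<in> E" by (auto simp: blank_edge_iff insert_commute)
      have "\<bar>y i - y j\<bar> < 1" using y ij unfolding proj0_rho[OF X] by auto
      then show "\<bar>z i - z j\<bar> < 1"
        using iff[OF z ij(2,1) e(1)] iff[OF z ij(1,2) e(2)] by (auto simp: abs_less_iff)
    qed
  qed
qed

text \<open>Since the sets are nonempty, equal images give two points that agree off coordinate 0,
  hence the same orientation away from the sink.\<close>

lemma inj_on_proj0_rho: "inj_on (proj0 n \<circ> rho n v E) (sink_semiorientations V E (v 0))"
proof (rule inj_onI, unfold comp_apply)
  fix X Y
  assume X: "X \<in> sink_semiorientations V E (v 0)" and Y: "Y \<in> sink_semiorientations V E (v 0)"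
    and eq: "proj0 n (rho n v E X) = proj0 n (rho n v E Y)"
  have po: "partial_orientation V E X" "partial_orientation V E Y"
    and out: "\<And>w. {v 0, w} \<in> E \<Longrightarrow> (v 0, w) \<in> X" "\<And>w. {v 0, w} \<in> E \<Longrightarrow> (v 0, w) \<in> Y"
    using X Y by (auto simp: sink_semiorientations_iff semiorientation_def)
  obtain x where x: "x \<in> rho n v E X"
    using semiorientation_imp_rho_nonempty X by (auto simp: sink_semiorientations_iff)
  then have "restrict x {1..n} \<in> proj0 n (rho n v E Y)"
    unfolding eq[symmetric] by (auto simp: proj0_def)
  then obtain y where y: "y \<in> rho n v E Y" "restrict x {1..n} = restrict y {1..n}"
    by (auto simp: proj0_def)
  have xy: "x i = y i" if "i \<noteq> 0" "i \<le> n" for i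
    using fun_cong[OF y(2), of i] that by simp
  have "(v i, v j) \<in> orient x \<longleftrightarrow> (v i, v j) \<in> orient y" if ij: "i \<le> n" "j \<le> n" for i j
  proof (cases "i = 0 \<or> j = 0")
    case False
    then show ?thesis using xy ij by (simp add: orient_iff)
  next
    case True
    \<comment> \<open>At the sink both orientations are dictated by \<open>E\<close>: all arcs leave
      and none enter.\<close>
    have "(v 0, w) \<in> Z \<longleftrightarrow> {v 0, w} \<in> E" "(w, v 0) \<notin> Z"
      if "partial_orientation V E Z" "\<And>w. {v 0, w} \<in> E \<Longrightarrow> (v 0, w) \<in> Z" for Z w
      using that unfolding partial_orientation_def by (auto simp: insert_commute)
    from this[OF po(1) out(1)] this[OF po(2) out(2)] show ?thesis
      using True orient_eq[OF po(1) x] orient_eq[OF po(2) y(1)] by metis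
  qed
  then have "orient x = orient y" unfolding orient_def by blast
  then show "X = Y" using orient_eq[OF po(1) x] orient_eq[OF po(2) y(1)] by simp
qed

text \<open>Each image is nonempty and is the component of any of its points; conversely, the base
  point of a component lies in some image.\<close>

lemma proj0_rho_image:
  "(proj0 n \<circ> rho n v E) ` sink_semiorientations V E (v 0)
    = regions n (semiorder_arrangement n v E)"
proof (intro equalityI subsetI)
  fix C assume "C \<in> (proj0 n \<circ> rho n v E) ` sink_semiorientations V E (v 0)"
  then obtain X where X: "X \<in> sink_semiorientations V E (v 0)" "C = proj0 n (rho n v E X)" by auto
  then obtain y where y: "y \<in> C"
    using semiorientation_imp_rho_nonempty by (fastforce simp: proj0_def sink_semiorientations_iff)
  then have yA: "y \<in> arrangement_complement" using proj0_rho_subset X by blast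
  have "C = connected_component_of_set (subtopology (powertop_real {1..n}) arrangement_complement) y"
    using connected_component_eq_proj0_rho[OF X(1)] y X(2) by simp
  then show "C \<in> regions n (semiorder_arrangement n v E)"
    unfolding regions_def connected_components_of_def topspace_subtopology using yA by blast
next
  fix C assume "C \<in> regions n (semiorder_arrangement n v E)"
  then obtain y where y: "y \<in> arrangement_complement"
    and C: "C = connected_component_of_set (subtopology (powertop_real {1..n}) arrangement_complement) y"
    unfolding regions_def connected_components_of_def by auto
  obtain X where X: "X \<in> sink_semiorientations V E (v 0)" "y \<in> proj0 n (rho n v E X)"
    using sink_semiorientation_of_point[OF y] by blast
  then show "C \<in> (proj0 n \<circ> rho n v E) ` sink_semiorientations V E (v 0)"
    using connected_component_eq_proj0_rho C by auto
qed

end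

theorem theorem4p7:
  fixes V :: "'a set" and E :: "'a set set" and v :: "nat \<Rightarrow> 'a" and n :: nat
  assumes "finite_simple_graph V E"
    and "connected_graph V E"
    and "bij_betw v {0..n} V"
  shows "bij_betw (proj0 n \<circ> rho n v E)
           (sink_semiorientations V E (v 0))
           (regions n (semiorder_arrangement n v E))"
proof -
  interpret enumerated_graph V E v n
    using assms(1,3) by unfold_locales
  show ?thesis
    unfolding bij_betw_def using inj_on_proj0_rho proj0_rho_image by blast
qed

end
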